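(* Let $d\ge 1$ and let $p_0=\mathcal N(\mu_0,\Sigma)$ be a Gaussian density on $\mathbb{R}^d$ with $\Sigma\succ 0$, so that $s_0(x)=\nabla_x\log p_0(x)=-\Sigma^{-1}(x-\mu_0)$. Fix $t>0$ and $y\in\mathbb{R}^d$, and let $x_0^1,\dots,x_0^{N_{\mathrm{ref}}}$ be i.i.d. samples from $p_0$. Define the weights $$w_i:=p_{t|0}(y\mid x_0^i)=\mathcal N\big(y;\,e^{-t}x_0^i,\,(1-e^{-2t})I\big),\qquad \tilde w_i:=\frac{w_i}{\sum_{j=1}^{N_{\mathrm{ref}}}w_j},$$ the estimators $$\widehat s_{\mathrm{TSI}}(y,t)=e^{t}\sum_{i=1}^{N_{\mathrm{ref}}}\tilde w_i\,s_0(x_0^i),\qquad \widehat s_{\mathrm{TWD}}(y,t)=-\frac{1}{1-e^{-2t}}\sum_{i=1}^{N_{\mathrm{ref}}}\tilde w_i\,\big(y-e^{-t}x_0^i\big),$$ and $$\hat\mu_{\mathrm{SNIS}}:=\sum_{i=1}^{N_{\mathrm{ref}}}\tilde w_i x_0^i,\qquad \mu:=\mathbb{E}_{p_0}[\hat\mu_{\mathrm{SNIS}}],\qquad \Delta:=\hat\mu_{\mathrm{SNIS}}-\mu,$$ where $\mathbb{E}_{p_0}$ denotes expectation over the i.i.d. reference samples. Then the deviations $$\varepsilon_{\mathrm C}:=\widehat s_{\mathrm{TSI}}-\mathbb{E}_{p_0}[\widehat s_{\mathrm{TSI}}],\qquad \varepsilon_{\mathrm T}:=\widehat s_{\mathrm{TWD}}-\mathbb{E}_{p_0}[\widehat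 s_{\mathrm{TWD}}]$$ satisfy $\varepsilon_{\mathrm C}=-e^{t}\Sigma^{-1}\Delta$ and $\varepsilon_{\mathrm T}=\frac{e^{-t}}{1-e^{-2t}}\Delta$, and hence $$\operatorname{Tr}\big[\mathrm{Cov}_{p_0}(\varepsilon_{\mathrm C},\varepsilon_{\mathrm T})\big]=\mathbb{E}_{p_0}\big[\varepsilon_{\mathrm T}^{\top}\varepsilon_{\mathrm C}\big]=-\frac{1}{1-e^{-2t}}\,\mathbb{E}_{p_0}\big[\Delta^{\top}\Sigma^{-1}\Delta\big]\le 0,$$ with equality if and only if $\Delta=0$ almost surely.
   Context: $p_{t|0}(\cdot\mid x_0)$ is the transition density of the Ornstein–Uhlenbeck process $dX_t=-X_t\,dt+\sqrt2\,dW_t$, i.e. $p_{t|0}(x_t\mid x_0)=\mathcal N(x_t;e^{-t}x_0,(1-e^{-2t})I)$. $\widehat s_{\mathrm{TSI}}$ and $\widehat s_{\mathrm{TWD}}$ are self-normalized importance sampling estimators (Target Score Identity and Tweedie estimators) of the score $\nabla_y\log p_t(y)$ of the time-$t$ marginal $p_t(y)=\int p_{t|0}(y\mid x)p_0(x)\,dx$. *)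

theory Defs
  imports "HOL-Probability.Probability"
begin

text \<open>Symmetric positive definite matrices.\<close>
definition pos_def_mat :: "real^'d^'d \<Rightarrow> bool" where
  "pos_def_mat S \<longleftrightarrow> transpose S = S \<and> (\<forall>x. x \<noteq> 0 \<longrightarrow> x \<bullet> (S *v x) > 0)"

text \<open>Density of the multivariate normal N(mu, S) on R^d.\<close>
definition gauss_density :: "real^'d \<Rightarrow> real^'d^'d \<Rightarrow> real^'d \<Rightarrow> real" where
  "gauss_density mu S x =
     exp (- (1/2) * ((x - mu) \<bullet> (matrix_inv S *v (x - mu))))
     / sqrt ((2 * pi) ^ CARD('d) * det S)"

text \<open>Score of the Gaussian p0 = N(mu0, S).\<close>
definition gauss_score :: "real^'d \<Rightarrow> real^'d^'d \<Rightarrow> real^'d \<Rightarrow> real^'d" where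
  "gauss_score mu0 S x = - (matrix_inv S *v (x - mu0))"

text \<open>OU transition density p_{t|0}(y | x) = N(y; e^{-t} x, (1 - e^{-2t}) I).\<close>
definition ou_kernel :: "real \<Rightarrow> real^'d \<Rightarrow> real^'d \<Rightarrow> real" where
  "ou_kernel t y x = gauss_density (exp (-t) *\<^sub>R x) ((1 - exp (-2*t)) *\<^sub>R mat 1) y"

text \<open>Self-normalised weights, samples indexed by 1..N.\<close>
definition snis_weight :: "real \<Rightarrow> real^'d \<Rightarrow> nat \<Rightarrow> (nat \<Rightarrow> real^'d) \<Rightarrow> nat \<Rightarrow> real" where
  "snis_weight t y N X i = ou_kernel t y (X i) / (\<Sum>j\<in>{1..N}. ou_kernel t y (X j))"

definition s_TSI :: "real^'d \<Rightarrow> real^'d^'d \<Rightarrow> real \<Rightarrow> real^'d \<Rightarrow> nat \<Rightarrow> (nat \<Rightarrow> real^'d) \<Rightarrow> real^'d" where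
  "s_TSI mu0 S t y N X = exp t *\<^sub>R (\<Sum>i\<in>{1..N}. snis_weight t y N X i *\<^sub>R gauss_score mu0 S (X i))"

definition s_TWD :: "real \<Rightarrow> real^'d \<Rightarrow> nat \<Rightarrow> (nat \<Rightarrow> real^'d) \<Rightarrow> real^'d" where
  "s_TWD t y N X = - (1 / (1 - exp (-2*t))) *\<^sub>R
      (\<Sum>i\<in>{1..N}. snis_weight t y N X i *\<^sub>R (y - exp (-t) *\<^sub>R X i))"

definition mu_SNIS :: "real \<Rightarrow> real^'d \<Rightarrow> nat \<Rightarrow> (nat \<Rightarrow> real^'d) \<Rightarrow> real^'d" where
  "mu_SNIS t y N X = (\<Sum>i\<in>{1..N}. snis_weight t y N X i *\<^sub>R X i)"

text \<open>Cross-covariance matrix Cov(U,V) = E[(U - EU)(V - EV)^T].\<close>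
definition cross_cov :: "'s measure \<Rightarrow> ('s \<Rightarrow> real^'d) \<Rightarrow> ('s \<Rightarrow> real^'d) \<Rightarrow> real^'d^'d" where
  "cross_cov M U V = (\<chi> i j. \<integral>w. (U w $ i - (\<integral>v. U v $ i \<partial>M)) * (V w $ j - (\<integral>v. V v $ j \<partial>M)) \<partial>M)"

text \<open>Law of N i.i.d. reference samples from p0 = N(mu0, S), indexed by 1..N.\<close>
definition ref_samples :: "nat \<Rightarrow> real^'d \<Rightarrow> real^'d^'d \<Rightarrow> (nat \<Rightarrow> real^'d) measure" where
  "ref_samples N mu0 S = PiM {1..N} (\<lambda>_. density lborel (\<lambda>x. ennreal (gauss_density mu0 S x)))"

end

theory Submission
  imports Defs
begin

text \<open>
  Because the weights sum to one and the Gaussian score is affine, both estimators are affine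
  functions of the self-normalised mean: \<open>s_TSI = - e\<^sup>t \<Sigma>\<inverse> (\<mu>_SNIS - \<mu>\<^sub>0)\<close> and
  \<open>s_TWD = (e\<^sup>-\<^sup>t \<mu>_SNIS - y) / (1 - e\<^sup>-\<^sup>2\<^sup>t)\<close>. Their deviations from their means are
  therefore the linear images \<open>- e\<^sup>t \<Sigma>\<inverse> \<Delta>\<close> and \<open>e\<^sup>-\<^sup>t / (1 - e\<^sup>-\<^sup>2\<^sup>t) \<Delta>\<close> of one
  centred vector \<open>\<Delta>\<close>, and the trace of their cross-covariance is
  \<open>- E[\<Delta>\<^sup>T \<Sigma>\<inverse> \<Delta>] / (1 - e\<^sup>-\<^sup>2\<^sup>t)\<close>, a negative multiple of a positive definite quadratic
  form.

  What needs work is integrability. Since \<open>\<mu>_SNIS\<close> is a convex combination of the samples,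
  \<open>|\<mu>_SNIS|\<^sup>2 \<le> \<Sum>\<^sub>i |x\<^sub>i|\<^sup>2\<close>, so it suffices that \<open>p\<^sub>0\<close> has a finite second moment. This and
  the normalisation of \<open>p\<^sub>0\<close> follow from the substitution \<open>x = \<mu>\<^sub>0 + L z\<close> with
  \<open>L\<^sup>T \<Sigma>\<inverse> L = I\<close> (an \<open>\<Sigma>\<inverse>\<close>-orthonormal basis obtained by Gram--Schmidt), which turns
  \<open>p\<^sub>0\<close> into the product of one-dimensional standard normal densities.
\<close>

section \<open>Preliminaries on vectors and matrices\<close>

lemma prod_Basis_cart: "(\<Prod>b\<in>Basis. (x::real^'n) \<bullet> b) = (\<Prod>i\<in>UNIV. x $ i)"
  by (simp add: Basis_vec_def cart_eq_inner_axis axis_eq_axis prod.UNION_disjoint)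

lemma norm_sq_eq_sum_Basis: "(norm x)\<^sup>2 = (\<Sum>b\<in>Basis. (x \<bullet> b)\<^sup>2)"
  unfolding power2_norm_eq_inner by (subst euclidean_inner) (simp add: power2_eq_square)

lemma component_sq_le_norm_sq_cart: "(x $ i)\<^sup>2 \<le> (norm (x :: real^'n::finite))\<^sup>2"
  using component_le_norm_cart[of x i] by (simp add: abs_le_square_iff[symmetric])

lemma norm_add_sq_le: "(norm (x + y))\<^sup>2 \<le> 2 * (norm x)\<^sup>2 + 2 * (norm y)\<^sup>2"
proof -
  have "(norm (x + y))\<^sup>2 \<le> (norm x + norm y)\<^sup>2"
    by (simp add: norm_triangle_ineq power_mono)
  also have "\<dots> \<le> 2 * (norm x)\<^sup>2 + 2 * (norm y)\<^sup>2"
    using zero_le_power2[of "norm x - norm y"] unfolding power2_diff power2_sum by linarith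
  finally show ?thesis .
qed

lemma norm_convex_combination_sq_le:
  fixes x :: "'i \<Rightarrow> 'a::real_normed_vector"
  assumes "finite I" and "\<And>i. i \<in> I \<Longrightarrow> w i \<ge> 0" and "sum w I = 1"
  shows "(norm (\<Sum>i\<in>I. w i *\<^sub>R x i))\<^sup>2 \<le> (\<Sum>i\<in>I. (norm (x i))\<^sup>2)"
proof -
  define R where "R = sqrt (\<Sum>i\<in>I. (norm (x i))\<^sup>2)"
  have "norm (x i) \<le> R" if "i \<in> I" for i
    unfolding R_def using assms(1) that
    by (intro real_le_rsqrt member_le_sum) auto
  then have "norm (\<Sum>i\<in>I. w i *\<^sub>R x i) \<le> (\<Sum>i\<in>I. w i * R)"
    using assms(2) by (intro order_trans[OF norm_sum] sum_mono) (simp add: mult_left_mono)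
  also have "\<dots> = R"
    using assms(3) by (simp add: sum_distrib_right[symmetric])
  finally have "(norm (\<Sum>i\<in>I. w i *\<^sub>R x i))\<^sup>2 \<le> R\<^sup>2"
    by (simp add: power_mono)
  then show ?thesis
    by (simp add: R_def sum_nonneg)
qed

lemma inner_matrix_vector_mult_transpose:
  fixes L :: "real^'n::finite^'m::finite"
  shows "(L *v x) \<bullet> y = x \<bullet> (transpose L *v y)"
  by (metis dot_lmul_matrix inner_commute transpose_matrix_vector)

lemma borel_measurable_bounded_linear: "bounded_linear T \<Longrightarrow> T \<in> borel_measurable borel"
  by (intro borel_measurable_continuous_onI linear_continuous_on)

lemma borel_measurable_matrix_vector_mult [measurable (raw)]:
  assumes "f \<in> borel_measurable M"
  shows "(\<lambda>x. (A :: real^'n::finite^'m::finite) *v f x) \<in> borel_measurable M"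
  using measurable_compose[OF assms borel_measurable_continuous_onI[OF linear_continuous_on[OF
        matrix_vector_mul_bounded_linear[of A]]]] by (simp add: o_def)

lemma borel_measurable_vec_nth [measurable (raw)]:
  "f \<in> borel_measurable M \<Longrightarrow> (\<lambda>x. (f x :: real^'n::finite) $ i) \<in> borel_measurable M"
  by (rule measurable_compose[OF _ borel_measurable_nth])

lemma emeasure_lborel_box_cart:
  fixes l u :: "real^'n::finite"
  assumes "\<And>i. l $ i \<le> u $ i"
  shows "emeasure lborel (box l u) = (\<Prod>i\<in>UNIV. u $ i - l $ i)"
proof -
  have "emeasure lborel (box l u) = (\<Prod>b\<in>Basis. (u - l) \<bullet> b)"
    using assms by (intro emeasure_lborel_box) (auto simp: Basis_vec_def inner_axis)
  then show ?thesis by (simp add: prod_Basis_cart)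
qed

section \<open>Linear change of variables for Lebesgue measure\<close>

text \<open>
  The library proves the linear change of variables only for index types of class
  \<^class>\<open>wellorder\<close>. An arbitrary finite index type is transported to its copy
  \<open>'a ranked\<close>, ordered through \<^const>\<open>to_nat\<close>; this relabelling of coordinates preserves
  Lebesgue measure and determinants.
\<close>

typedef 'a ranked = "UNIV :: 'a set" by simp

instance ranked :: (finite) finite
  by standard (metis finite_imageI finite type_definition.Abs_image type_definition_ranked)

instantiation ranked :: (finite) linorder
begin
definition less_eq_ranked :: "'a ranked \<Rightarrow> 'a ranked \<Rightarrow> bool"
  where "x \<le> y \<longleftrightarrow> to_nat (Rep_ranked x) \<le> to_nat (Rep_ranked y)"
definition less_ranked :: "'a ranked \<Rightarrow> 'a ranked \<Rightarrow> bool"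
  where "x < y \<longleftrightarrow> to_nat (Rep_ranked x) < to_nat (Rep_ranked y)"
instance
  by standard (auto simp: less_eq_ranked_def less_ranked_def Rep_ranked_inject)
end

instance ranked :: (finite) wellorder
proof
  fix P :: "'a ranked \<Rightarrow> bool" and a :: "'a ranked"
  assume step: "\<And>x. (\<And>y. y < x \<Longrightarrow> P y) \<Longrightarrow> P x"
  have "\<forall>a. to_nat (Rep_ranked a) = n \<longrightarrow> P a" for n
    by (induction n rule: less_induct) (metis step less_ranked_def)
  then show "P a" by blast
qed

lemma bij_Abs_ranked: "bij Abs_ranked"
  by (rule bij_betw_byWitness[where f'=Rep_ranked]) (auto simp: Abs_ranked_inverse Rep_ranked_inverse)

lemma bij_Rep_ranked: "bij Rep_ranked"
  by (rule bij_betw_byWitness[where f'=Abs_ranked]) (auto simp: Abs_ranked_inverse Rep_ranked_inverse)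

definition vec_to_ranked :: "real^'n::finite \<Rightarrow> real^'n ranked"
  where "vec_to_ranked x = (\<chi> i. x $ Rep_ranked i)"

definition vec_of_ranked :: "real^'n::finite ranked \<Rightarrow> real^'n"
  where "vec_of_ranked y = (\<chi> j. y $ Abs_ranked j)"

lemma vec_to_of_ranked [simp]:
  "vec_to_ranked (vec_of_ranked y) = y" "vec_of_ranked (vec_to_ranked x) = x"
  by (simp_all add: vec_to_ranked_def vec_of_ranked_def vec_eq_iff Abs_ranked_inverse Rep_ranked_inverse)

lemma linear_vec_to_ranked: "linear vec_to_ranked"
  and linear_vec_of_ranked: "linear vec_of_ranked"
  by (auto simp: linear_iff vec_to_ranked_def vec_of_ranked_def vec_eq_iff)

lemma borel_measurable_vec_to_ranked [measurable]: "vec_to_ranked \<in> borel_measurable borel"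
  and borel_measurable_vec_of_ranked [measurable]: "vec_of_ranked \<in> borel_measurable borel"
  by (simp_all add: borel_measurable_continuous_onI linear_continuous_on linear_linear
        linear_vec_to_ranked linear_vec_of_ranked)

lemma vimage_vec_to_ranked_box:
  "vec_to_ranked -` box l u = box (vec_of_ranked l) (vec_of_ranked u)"
  by (auto simp: mem_box_cart vec_to_ranked_def vec_of_ranked_def Abs_ranked_inverse)
    (metis Abs_ranked_inverse Rep_ranked_inverse UNIV_I)+

lemma distr_vec_to_ranked_lborel: "distr lborel borel vec_to_ranked = lborel"
proof (rule lborel_eqI[symmetric])
  fix l u :: "real^'n::finite ranked"
  assume lu: "\<And>b. b \<in> Basis \<Longrightarrow> l \<bullet> b \<le> u \<bullet> b"
  have "l $ i \<le> u $ i" for i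
    using lu[of "axis i 1"] by (simp add: inner_axis)
  then have "emeasure (distr lborel borel vec_to_ranked) (box l u)
      = (\<Prod>j\<in>UNIV. u $ Abs_ranked j - l $ Abs_ranked j)"
    by (simp add: emeasure_distr vimage_vec_to_ranked_box emeasure_lborel_box_cart vec_of_ranked_def)
  also have "\<dots> = (\<Prod>b\<in>Basis. (u - l) \<bullet> b)"
    using prod.reindex_bij_betw[OF bij_Abs_ranked, of "\<lambda>i. u $ i - l $ i"]
    by (simp add: prod_Basis_cart)
  finally show "emeasure (distr lborel borel vec_to_ranked) (box l u) = (\<Prod>b\<in>Basis. (u - l) \<bullet> b)" .
qed simp

definition mat_to_ranked :: "'a::comm_ring_1^'n::finite^'n \<Rightarrow> 'a^'n ranked^'n ranked"
  where "mat_to_ranked L = (\<chi> i j. L $ Rep_ranked i $ Rep_ranked j)"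

lemma det_mat_to_ranked:
  fixes L :: "'a::comm_ring_1^'n::finite^'n"
  shows "det (mat_to_ranked L) = det L"
proof -
  let ?to = "map_permutation (UNIV :: 'n ranked set) Rep_ranked"
  let ?of = "map_permutation (UNIV :: 'n set) Abs_ranked"
  have "(\<Sum>q | q permutes (UNIV :: 'n ranked set).
          of_int (sign q) * (\<Prod>i\<in>UNIV. mat_to_ranked L $ i $ q i))
      = (\<Sum>p | p permutes (UNIV :: 'n set). of_int (sign p) * (\<Prod>j\<in>UNIV. L $ j $ p j))"
  proof (rule sum.reindex_bij_witness[where i = ?of and j = ?to])
    fix q assume q: "q \<in> {q. q permutes (UNIV :: 'n ranked set)}"
    show "?of (?to q) = q"
      using q by (intro map_permutation_compose_inv[OF bij_Rep_ranked]) (auto simp: Rep_ranked_inverse)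
    show "?to q \<in> {p. p permutes UNIV}"
      using q map_permutation_permutes[OF bij_Rep_ranked] by auto
    have "?to q (Rep_ranked i) = Rep_ranked (q i)" for i
      by (rule map_permutation_apply) (auto simp: bij_is_inj[OF bij_Rep_ranked])
    then have "(\<Prod>j\<in>UNIV. L $ j $ ?to q j) = (\<Prod>i\<in>UNIV. mat_to_ranked L $ i $ q i)"
      using prod.reindex_bij_betw[OF bij_Rep_ranked, of "\<lambda>j. L $ j $ ?to q j"]
      by (simp add: mat_to_ranked_def)
    moreover have "sign (?to q) = sign q"
      using q by (intro sign_map_permutation) (auto simp: bij_is_inj[OF bij_Rep_ranked])
    ultimately show "of_int (sign (?to q)) * (\<Prod>j\<in>UNIV. L $ j $ ?to q j)
        = of_int (sign q) * (\<Prod>i\<in>UNIV. mat_to_ranked L $ i $ q i)"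
      by simp
  next
    fix p assume p: "p \<in> {p. p permutes (UNIV :: 'n set)}"
    show "?to (?of p) = p"
      using p by (intro map_permutation_compose_inv[OF bij_Abs_ranked]) (auto simp: Abs_ranked_inverse)
    show "?of p \<in> {q. q permutes UNIV}"
      using p map_permutation_permutes[OF bij_Abs_ranked] by auto
  qed
  then show ?thesis
    unfolding det_def .
qed

lemma mat_to_ranked_mult_vec:
  fixes L :: "real^'n::finite^'n"
  shows "mat_to_ranked L *v vec_to_ranked x = vec_to_ranked (L *v x)"
proof -
  have "(\<Sum>k\<in>UNIV. L $ Rep_ranked i $ Rep_ranked k * x $ Rep_ranked k) = (\<Sum>j\<in>UNIV. L $ Rep_ranked i $ j * x $ j)"
    for i :: "'n ranked"
    by (rule sum.reindex_bij_betw[OF bij_Rep_ranked])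
  then show ?thesis
    by (simp add: vec_eq_iff matrix_vector_mult_def mat_to_ranked_def vec_to_ranked_def)
qed

lemma lborel_matrix_linear:
  fixes L :: "real^'n::{finite,wellorder}^'n::{finite,wellorder}"
  assumes "det L \<noteq> 0"
  shows "lborel = density (distr lborel borel ((*v) L)) (\<lambda>_. ennreal \<bar>det L\<bar>)"
proof (rule lborel_eqI)
  fix l u :: "real^'n::{finite,wellorder}" assume lu: "\<And>b. b \<in> Basis \<Longrightarrow> l \<bullet> b \<le> u \<bullet> b"
  obtain L' where L': "L' ** L = mat 1" "L ** L' = mat 1"
    using assms invertible_det_nz invertible_def by blast
  have "(*v) L -` box l u \<in> sets borel"
    by (intro borel_open continuous_open_vimage open_box continuous_intros)
  moreover have "(*v) L -` box l u = (*v) L' ` box l u"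
    using L' by (auto simp: image_iff matrix_vector_mul_assoc) (metis matrix_vector_mul_assoc matrix_vector_mul_lid)
  ultimately have "emeasure lborel ((*v) L -` box l u) = emeasure lebesgue ((*v) L' ` box l u)"
    by simp
  also have "\<dots> = ennreal (measure lebesgue ((*v) L' ` box l u))"
    using measurable_linear_image[OF matrix_vector_mul_linear, of "box l u" L']
    by (simp add: emeasure_eq_measure2 lmeasurable_open)
  also have "\<dots> = ennreal (\<bar>det L'\<bar> * measure lborel (box l u))"
    using measure_linear_image[OF matrix_vector_mul_linear, of "box l u" L']
    by (simp add: lmeasurable_open)
  finally have "ennreal \<bar>det L\<bar> * emeasure lborel ((*v) L -` box l u) = measure lborel (box l u)"
    using L'(1) det_mul[of L' L] by (simp add: ennreal_mult'[symmetric] abs_mult[symmetric] mult.commute)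
  then show "emeasure (density (distr lborel borel ((*v) L)) (\<lambda>_. ennreal \<bar>det L\<bar>)) (box l u)
      = (\<Prod>b\<in>Basis. (u - l) \<bullet> b)"
    using lu by (simp add: emeasure_density_const emeasure_distr measure_lborel_box_eq)
qed simp

lemma nn_integral_lborel_vec_of_ranked:
  assumes [measurable]: "f \<in> borel_measurable borel"
  shows "(\<integral>\<^sup>+y. f (vec_of_ranked y) \<partial>lborel) = (\<integral>\<^sup>+x. f x \<partial>(lborel :: (real^'n::finite) measure))"
  by (subst distr_vec_to_ranked_lborel[symmetric]) (simp add: nn_integral_distr)

lemma nn_integral_lborel_linear:
  fixes L :: "real^'n::finite^'n" and f :: "real^'n \<Rightarrow> ennreal"
  assumes "det L \<noteq> 0" and [measurable]: "f \<in> borel_measurable borel"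
  shows "(\<integral>\<^sup>+x. f x \<partial>lborel) = \<bar>det L\<bar> * (\<integral>\<^sup>+z. f (L *v z) \<partial>lborel)"
proof -
  let ?L = "mat_to_ranked L"
  have "vec_of_ranked (?L *v w) = L *v vec_of_ranked w" for w
    using mat_to_ranked_mult_vec[of L "vec_of_ranked w"] by (metis vec_to_of_ranked)
  moreover have "(\<integral>\<^sup>+y. f (vec_of_ranked y) \<partial>lborel)
      = \<bar>det ?L\<bar> * (\<integral>\<^sup>+w. f (vec_of_ranked (?L *v w)) \<partial>lborel)"
    using assms(1)
    by (subst (1) lborel_matrix_linear[of ?L])
      (simp_all add: det_mat_to_ranked nn_integral_density nn_integral_distr nn_integral_cmult)
  moreover have "(\<integral>\<^sup>+w. f (L *v vec_of_ranked w) \<partial>lborel) = (\<integral>\<^sup>+z. f (L *v z) \<partial>lborel)"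
    by (rule nn_integral_lborel_vec_of_ranked[of "\<lambda>z. f (L *v z)"]) measurable
  ultimately show ?thesis
    by (simp add: det_mat_to_ranked nn_integral_lborel_vec_of_ranked)
qed

lemma nn_integral_lborel_affine:
  fixes L :: "real^'n::finite^'n" and f :: "real^'n \<Rightarrow> ennreal"
  assumes "det L \<noteq> 0" and [measurable]: "f \<in> borel_measurable borel"
  shows "(\<integral>\<^sup>+x. f x \<partial>lborel) = \<bar>det L\<bar> * (\<integral>\<^sup>+z. f (m + L *v z) \<partial>lborel)"
proof -
  have "(\<integral>\<^sup>+x. f x \<partial>lborel) = (\<integral>\<^sup>+x. f (m + x) \<partial>lborel)"
    by (subst lborel_distr_plus[symmetric, of m]) (simp add: nn_integral_distr)
  also have "\<dots> = \<bar>det L\<bar> * (\<integral>\<^sup>+z. f (m + L *v z) \<partial>lborel)"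
    using assms(1) by (rule nn_integral_lborel_linear) measurable
  finally show ?thesis .
qed

section \<open>Positive definite matrices\<close>

lemma pos_def_mat_inner_sym:
  assumes "pos_def_mat A"
  shows "x \<bullet> (A *v y) = y \<bullet> (A *v x)"
  using assms inner_matrix_vector_mult_transpose[of A y x]
  by (simp add: pos_def_mat_def inner_commute)

lemma pos_def_mat_nonneg:
  assumes "pos_def_mat A"
  shows "x \<bullet> (A *v x) \<ge> 0"
  using assms by (cases "x = 0") (auto simp: pos_def_mat_def less_imp_le)

lemma orthonormal_residual_orthogonal:
  fixes A :: "real^'n::finite^'n"
  assumes "finite K" and "j \<in> K"
    and orth: "\<And>i j. i \<in> K \<Longrightarrow> j \<in> K \<Longrightarrow> v i \<bullet> (A *v v j) = (if i = j then 1 else 0)"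
  shows "v j \<bullet> (A *v (u - (\<Sum>i\<in>K. (v i \<bullet> (A *v u)) *\<^sub>R v i))) = 0"
proof -
  have "v j \<bullet> (A *v (u - (\<Sum>i\<in>K. (v i \<bullet> (A *v u)) *\<^sub>R v i)))
      = v j \<bullet> (A *v u) - (\<Sum>i\<in>K. (v i \<bullet> (A *v u)) * (v j \<bullet> (A *v v i)))"
    by (simp add: matrix_vector_mult_diff_distrib linear_sum[OF matrix_vector_mul_linear] o_def
        matrix_vector_mult_scaleR inner_diff_right inner_sum_right)
  also have "(\<Sum>i\<in>K. (v i \<bullet> (A *v u)) * (v j \<bullet> (A *v v i))) = (\<Sum>i\<in>K. if i = j then v i \<bullet> (A *v u) else 0)"
    using assms(2) by (intro sum.cong) (auto simp: orth)
  also have "\<dots> = v j \<bullet> (A *v u)"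
    using assms(1,2) by simp
  finally show ?thesis
    by simp
qed

text \<open>Gram--Schmidt; the support condition makes the new vector nonzero, its \<open>k\<close>-th entry being 1.\<close>

lemma pos_def_mat_orthonormal_family:
  fixes A :: "real^'n::finite^'n" and K :: "'n set"
  assumes A: "pos_def_mat A" and "finite K"
  shows "\<exists>v. (\<forall>j\<in>K. \<forall>i. i \<notin> K \<longrightarrow> v j $ i = 0)
           \<and> (\<forall>i\<in>K. \<forall>j\<in>K. v i \<bullet> (A *v v j) = (if i = j then 1 else 0))"
  using \<open>finite K\<close>
proof (induction K rule: finite_induct)
  case (insert k K)
  then obtain v where supp: "\<And>j i. j \<in> K \<Longrightarrow> i \<notin> K \<Longrightarrow> v j $ i = 0"
    and orth: "\<And>i j. i \<in> K \<Longrightarrow> j \<in> K \<Longrightarrow> v i \<bullet> (A *v v j) = (if i = j then 1 else 0)"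
    by blast
  define w where "w = axis k 1 - (\<Sum>j\<in>K. (v j \<bullet> (A *v axis k 1)) *\<^sub>R v j)"
  have w_supp: "w $ i = (if i = k then 1 else 0)" if "i \<notin> K" for i
    using supp that by (simp add: w_def axis_def)
  then have "w \<noteq> 0"
    using insert.hyps(2) by (metis zero_index zero_neq_one)
  then have w_pos: "w \<bullet> (A *v w) > 0"
    using A by (simp add: pos_def_mat_def)
  have w_orth: "v j \<bullet> (A *v w) = 0" if "j \<in> K" for j
    unfolding w_def using insert.hyps(1) that orth by (rule orthonormal_residual_orthogonal)
  define v' where "v' = v(k := (1 / sqrt (w \<bullet> (A *v w))) *\<^sub>R w)"
  have "v' i \<bullet> (A *v v' j) = (if i = j then 1 else 0)" if "i \<in> insert k K" "j \<in> insert k K" for i j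
  proof (cases "i = k"; cases "j = k")
    assume "i = k" "j = k"
    then show ?thesis
      using w_pos by (simp add: v'_def matrix_vector_mult_scaleR power2_eq_square[symmetric])
  next
    assume "i = k" "j \<noteq> k"
    then show ?thesis
      using that w_orth[of j] pos_def_mat_inner_sym[OF A, of w "v j"]
      by (simp add: v'_def matrix_vector_mult_scaleR)
  next
    assume "i \<noteq> k" "j = k"
    then show ?thesis
      using that w_orth by (simp add: v'_def matrix_vector_mult_scaleR)
  next
    assume "i \<noteq> k" "j \<noteq> k"
    then show ?thesis
      using that by (simp add: v'_def orth)
  qed
  moreover have "v' j $ i = 0" if "j \<in> insert k K" "i \<notin> insert k K" for i j
    using that supp w_supp by (auto simp: v'_def)
  ultimately show ?case
    by blast
qed simp

lemma pos_def_mat_congruent_identity: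
  fixes A :: "real^'n::finite^'n"
  assumes "pos_def_mat A"
  obtains L :: "real^'n^'n" where "transpose L ** A ** L = mat 1"
proof -
  obtain v :: "'n \<Rightarrow> real^'n" where orth: "\<And>i j. v i \<bullet> (A *v v j) = (if i = j then 1 else 0)"
    using pos_def_mat_orthonormal_family[OF assms finite[of UNIV]] by auto
  let ?L = "\<chi> i j. v j $ i"
  have "(transpose ?L ** A ** ?L) $ i $ j = v i \<bullet> (A *v v j)" for i j
  proof -
    have "(transpose ?L ** A ** ?L) $ i $ j = ((transpose ?L ** A ** ?L) *v axis j 1) $ i"
      by (simp add: matrix_vector_mult_basis column_def)
    also have "\<dots> = (transpose ?L *v (A *v (?L *v axis j 1))) $ i"
      by (simp only: matrix_vector_mul_assoc matrix_mul_assoc)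
    also have "\<dots> = (transpose ?L *v (A *v v j)) $ i"
      by (simp add: matrix_vector_mult_basis column_def vec_eq_iff)
    also have "\<dots> = v i \<bullet> (A *v v j)"
      by (simp add: vector_matrix_mult_def inner_vec_def mult.commute)
    finally show ?thesis .
  qed
  then have "transpose ?L ** A ** ?L = mat 1"
    by (simp add: vec_eq_iff orth mat_def)
  then show thesis
    by (rule that)
qed

lemma det_congruent_identity:
  fixes A L :: "real^'n::finite^'n"
  assumes "transpose L ** A ** L = mat 1"
  shows "(det L)\<^sup>2 * det A = 1"
  using arg_cong[OF assms, of det] by (simp add: det_mul det_transpose power2_eq_square mult_ac)

lemma pos_def_mat_det_pos:
  fixes S :: "real^'n::finite^'n"
  assumes "pos_def_mat S"
  shows "det S > 0"
proof -
  obtain L :: "real^'n^'n" where "transpose L ** S ** L = mat 1"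
    using pos_def_mat_congruent_identity[OF assms] .
  then have "(det L)\<^sup>2 * det S = 1"
    by (rule det_congruent_identity)
  then show ?thesis
    by (metis zero_le_power2 zero_less_one zero_less_mult_iff linorder_not_le order_le_less)
qed

lemma invertible_matrix_inv_mult:
  fixes A :: "'a::semiring_1^'n^'m"
  assumes "invertible A"
  shows "A ** matrix_inv A = mat 1" and "matrix_inv A ** A = mat 1"
  using someI_ex[OF assms[unfolded invertible_def]] by (simp_all add: matrix_inv_def)

lemma pos_def_mat_invertible:
  fixes S :: "real^'n::finite^'n"
  assumes "pos_def_mat S"
  shows "invertible S"
  using assms unfolding invertible_left_inverse matrix_left_invertible_ker pos_def_mat_def
  by (metis inner_zero_right less_irrefl)

lemma pos_def_mat_matrix_inv:
  fixes S :: "real^'n::finite^'n"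
  assumes S: "pos_def_mat S"
  shows "pos_def_mat (matrix_inv S)"
proof -
  let ?A = "matrix_inv S"
  have SA: "S ** ?A = mat 1" and AS: "?A ** S = mat 1"
    using invertible_matrix_inv_mult[OF pos_def_mat_invertible[OF S]] by auto
  have "transpose ?A ** S = mat 1"
    using arg_cong[OF SA, of transpose] S by (simp add: matrix_transpose_mul transpose_mat pos_def_mat_def)
  then have "transpose ?A = transpose ?A ** (S ** ?A)"
    by (simp add: SA)
  also have "\<dots> = ?A"
    by (simp add: matrix_mul_assoc \<open>transpose ?A ** S = mat 1\<close>)
  finally have sym: "transpose ?A = ?A" .
  have "x \<bullet> (?A *v x) > 0" if "x \<noteq> 0" for x
  proof -
    have "S *v (?A *v x) = x"
      by (simp add: matrix_vector_mul_assoc SA)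
    then have "?A *v x \<noteq> 0" and "x \<bullet> (?A *v x) = (?A *v x) \<bullet> (S *v (?A *v x))"
      using that by (auto simp: inner_commute)
    then show ?thesis
      using S by (simp add: pos_def_mat_def)
  qed
  with sym show ?thesis
    by (simp add: pos_def_mat_def)
qed

section \<open>Gaussian densities\<close>

definition std_gaussian :: "'a::euclidean_space \<Rightarrow> real"
  where "std_gaussian x = (\<Prod>b\<in>Basis. std_normal_density (x \<bullet> b))"

lemma std_gaussian_eq:
  "std_gaussian (x::'a::euclidean_space) = exp (- (norm x)\<^sup>2 / 2) / sqrt (2 * pi) ^ DIM('a)"
  by (simp add: std_gaussian_def std_normal_density_def prod_dividef exp_sum[symmetric]
      norm_sq_eq_sum_Basis sum_negf sum_divide_distrib)

lemma std_gaussian_nonneg: "std_gaussian x \<ge> 0"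
  by (simp add: std_gaussian_def prod_nonneg)

lemma borel_measurable_std_gaussian [measurable]: "std_gaussian \<in> borel_measurable borel"
  unfolding std_gaussian_def by measurable

lemma nn_integral_std_gaussian: "(\<integral>\<^sup>+x. std_gaussian x \<partial>(lborel :: 'a::euclidean_space measure)) = 1"
proof -
  have "(\<integral>\<^sup>+x. std_gaussian x \<partial>(lborel :: 'a measure))
      = (\<Prod>b\<in>(Basis :: 'a set). \<integral>\<^sup>+x. std_normal_density x \<partial>lborel)"
    using nn_integral_lborel_prod[of "\<lambda>b x. ennreal (std_normal_density x)"]
    by (simp add: std_gaussian_def prod_ennreal[symmetric])
  also have "(\<integral>\<^sup>+x. std_normal_density x \<partial>lborel) = 1"
    by (subst nn_integral_eq_integral) auto
  finally show ?thesis by simp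
qed

lemma nn_integral_std_gaussian_norm_sq:
  "(\<integral>\<^sup>+x. std_gaussian x * (norm x)\<^sup>2 \<partial>(lborel :: 'a::euclidean_space measure)) = DIM('a)"
proof -
  define g :: "'a \<Rightarrow> 'a \<Rightarrow> real \<Rightarrow> ennreal"
    where "g b' b x = std_normal_density x * (if b = b' then x\<^sup>2 else 1)" for b' b x
  have "ennreal (std_gaussian x * (norm x)\<^sup>2) = (\<Sum>b'\<in>Basis. \<Prod>b\<in>Basis. g b' b (x \<bullet> b))" for x :: 'a
  proof -
    have "(\<Prod>b\<in>Basis. g b' b (x \<bullet> b)) = ennreal (std_gaussian x * (x \<bullet> b')\<^sup>2)" if "b' \<in> Basis" for b'
      using that by (simp add: g_def std_gaussian_def prod_ennreal prod.distrib)
    then show ?thesis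
      by (simp add: norm_sq_eq_sum_Basis sum_distrib_left sum_ennreal std_gaussian_nonneg)
  qed
  moreover have [measurable]: "g b' b \<in> borel_measurable borel" for b' b
    unfolding g_def by measurable
  ultimately have "(\<integral>\<^sup>+x. std_gaussian x * (norm x)\<^sup>2 \<partial>(lborel :: 'a measure))
      = (\<Sum>b'\<in>Basis. \<Prod>b\<in>Basis. \<integral>\<^sup>+x. g b' b x \<partial>lborel)"
    by (simp add: nn_integral_sum nn_integral_lborel_prod)
  moreover have "(\<integral>\<^sup>+x. g b' b x \<partial>lborel) = 1" for b' b
  proof (cases "b = b'")
    case True
    then show ?thesis
      using integral_std_normal_moment_even[of 1]
      by (simp add: g_def nn_integral_eq_integral integrable_std_normal_moment)
  next
    case False
    then show ?thesis
      by (simp add: g_def nn_integral_eq_integral)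
  qed
  ultimately show ?thesis
    by simp
qed

lemma integrable_std_gaussian_affine_norm_sq:
  fixes T :: "'a::euclidean_space \<Rightarrow> 'b::euclidean_space"
  assumes T: "bounded_linear T"
  shows "integrable lborel (\<lambda>z. std_gaussian z * (norm (m + T z))\<^sup>2)"
proof (rule Bochner_Integration.integrable_bound)
  define h where "h z = 2 * (norm m)\<^sup>2 * std_gaussian z + 2 * (onorm T)\<^sup>2 * (std_gaussian z * (norm z)\<^sup>2)"
    for z :: 'a
  have [measurable]: "T \<in> borel_measurable borel"
    using T by (rule borel_measurable_bounded_linear)
  show "(\<lambda>z. std_gaussian z * (norm (m + T z))\<^sup>2) \<in> borel_measurable lborel"
    by measurable
  have "integrable lborel (std_gaussian :: 'a \<Rightarrow> real)"
    and "integrable lborel (\<lambda>z::'a. std_gaussian z * (norm z)\<^sup>2)"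
    using nn_integral_std_gaussian[where 'a = 'a] nn_integral_std_gaussian_norm_sq[where 'a = 'a]
    by (auto intro!: integrableI_bounded simp: std_gaussian_nonneg of_nat_less_top)
  then show "integrable lborel h"
    unfolding h_def by (intro Bochner_Integration.integrable_add integrable_mult_right)
  have "(norm (m + T z))\<^sup>2 \<le> 2 * (norm m)\<^sup>2 + 2 * (onorm T)\<^sup>2 * (norm z)\<^sup>2" for z
    using norm_add_sq_le[of m "T z"] power_mono[OF onorm[OF T, of z] norm_ge_zero, of 2]
    by (simp add: power_mult_distrib)
  from mult_left_mono[OF this std_gaussian_nonneg]
  show "AE z in lborel. norm (std_gaussian z * (norm (m + T z))\<^sup>2) \<le> norm (h z)"
    by (intro AE_I2) (simp add: h_def std_gaussian_nonneg algebra_simps)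
qed

lemma gauss_density_pos:
  assumes "pos_def_mat S"
  shows "gauss_density mu S x > 0"
  using pos_def_mat_det_pos[OF assms] by (simp add: gauss_density_def)

lemma borel_measurable_gauss_density [measurable]: "gauss_density mu S \<in> borel_measurable borel"
  unfolding gauss_density_def by measurable

lemma gauss_density_standardize:
  fixes S :: "real^'n::finite^'n"
  assumes S: "pos_def_mat S"
  obtains L :: "real^'n^'n"
  where "det L \<noteq> 0" and "\<And>z. gauss_density mu S (mu + L *v z) = std_gaussian z / \<bar>det L\<bar>"
proof -
  let ?A = "matrix_inv S"
  obtain L :: "real^'n^'n" where L: "transpose L ** ?A ** L = mat 1"
    using pos_def_mat_congruent_identity[OF pos_def_mat_matrix_inv[OF S]] .
  have "(det L)\<^sup>2 * det ?A * det S = det S"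
    using det_congruent_identity[OF L] by simp
  moreover have "det ?A * det S = 1"
    using invertible_matrix_inv_mult(2)[OF pos_def_mat_invertible[OF S]] by (metis det_I det_mul)
  ultimately have det: "det S = (det L)\<^sup>2"
    by (metis mult.assoc mult.right_neutral)
  then have "det L \<noteq> 0"
    using pos_def_mat_det_pos[OF S] by auto
  have "(L *v z) \<bullet> (?A *v (L *v z)) = z \<bullet> ((transpose L ** ?A ** L) *v z)" for z
    by (simp add: inner_matrix_vector_mult_transpose matrix_vector_mul_assoc matrix_mul_assoc)
  then have "(L *v z) \<bullet> (?A *v (L *v z)) = (norm z)\<^sup>2" for z
    by (simp add: L power2_norm_eq_inner)
  moreover have "sqrt ((2 * pi) ^ CARD('n) * det S) = sqrt (2 * pi) ^ CARD('n) * \<bar>det L\<bar>"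
    by (simp only: det real_sqrt_mult real_sqrt_abs real_sqrt_power[of "2 * pi"])
  ultimately have "gauss_density mu S (mu + L *v z) = std_gaussian z / \<bar>det L\<bar>" for z
    by (simp add: gauss_density_def std_gaussian_eq)
  with \<open>det L \<noteq> 0\<close> show thesis
    by (rule that)
qed

abbreviation gaussian_measure :: "real^'n::finite \<Rightarrow> real^'n^'n \<Rightarrow> (real^'n) measure"
  where "gaussian_measure mu S \<equiv> density lborel (\<lambda>x. ennreal (gauss_density mu S x))"

lemma nn_integral_gauss_density:
  fixes S :: "real^'n::finite^'n"
  assumes "pos_def_mat S"
  shows "(\<integral>\<^sup>+x. gauss_density mu S x \<partial>lborel) = 1"
proof -
  obtain L :: "real^'n^'n"
    where L: "det L \<noteq> 0" "\<And>z::real^'n. gauss_density mu S (mu + L *v z) = std_gaussian z / \<bar>det L\<bar>"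
    using gauss_density_standardize[OF assms, where mu = mu] by blast
  have "(\<integral>\<^sup>+x. gauss_density mu S x \<partial>lborel) = \<bar>det L\<bar> * (\<integral>\<^sup>+z. std_gaussian (z::real^'n) / \<bar>det L\<bar> \<partial>lborel)"
    by (subst nn_integral_lborel_affine[OF L(1), of _ mu]) (simp_all add: L(2))
  also have "\<dots> = (\<integral>\<^sup>+z. std_gaussian (z::real^'n) \<partial>lborel)"
    using L(1) by (simp add: nn_integral_cmult[symmetric] ennreal_mult'[symmetric] std_gaussian_nonneg)
  finally show ?thesis
    by (simp add: nn_integral_std_gaussian)
qed

lemma nn_integral_gauss_density_norm_sq_finite:
  fixes S :: "real^'n::finite^'n"
  assumes "pos_def_mat S"
  shows "(\<integral>\<^sup>+x. gauss_density mu S x * (norm x)\<^sup>2 \<partial>lborel) < \<infinity>"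
proof -
  obtain L :: "real^'n^'n"
    where L: "det L \<noteq> 0" "\<And>z::real^'n. gauss_density mu S (mu + L *v z) = std_gaussian z / \<bar>det L\<bar>"
    using gauss_density_standardize[OF assms, where mu = mu] by blast
  have "(\<integral>\<^sup>+x. gauss_density mu S x * (norm x)\<^sup>2 \<partial>lborel)
      = \<bar>det L\<bar> * (\<integral>\<^sup>+z. std_gaussian z / \<bar>det L\<bar> * (norm (mu + L *v z))\<^sup>2 \<partial>lborel)"
    by (subst nn_integral_lborel_affine[OF L(1), of _ mu]) (simp_all add: L(2))
  also have "\<dots> = (\<integral>\<^sup>+z. std_gaussian z * (norm (mu + L *v z))\<^sup>2 \<partial>lborel)"
    using L(1) by (simp add: nn_integral_cmult[symmetric] ennreal_mult'[symmetric] std_gaussian_nonneg)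
  also have "\<dots> < \<infinity>"
    using integrable_std_gaussian_affine_norm_sq[OF matrix_vector_mul_bounded_linear, of mu L]
    by (simp add: integrable_iff_bounded std_gaussian_nonneg)
  finally show ?thesis .
qed

lemma prob_space_gaussian_measure:
  fixes S :: "real^'n::finite^'n"
  assumes "pos_def_mat S"
  shows "prob_space (gaussian_measure mu S)"
  by standard (simp add: emeasure_density nn_integral_gauss_density[OF assms])

lemma integrable_gaussian_measure_norm_sq:
  fixes S :: "real^'n::finite^'n"
  assumes "pos_def_mat S"
  shows "integrable (gaussian_measure mu S) (\<lambda>x. (norm x)\<^sup>2)"
  using nn_integral_gauss_density_norm_sq_finite[OF assms, of mu] gauss_density_pos[OF assms, of mu]
  by (simp add: integrable_iff_bounded nn_integral_density ennreal_mult'[symmetric] less_imp_le)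

section \<open>Square-integrable random vectors\<close>

lemma (in finite_measure) integrable_of_integrable_norm_sq:
  fixes f :: "'a \<Rightarrow> 'b::{banach, second_countable_topology}"
  assumes [measurable]: "f \<in> borel_measurable M" and "integrable M (\<lambda>x. (norm (f x))\<^sup>2)"
  shows "integrable M f"
  using square_integrable_imp_integrable[of "\<lambda>x. norm (f x)"] assms(2)
  by (simp add: integrable_norm_iff)

lemma (in finite_measure) integrable_norm_sq_affine:
  fixes f :: "'a \<Rightarrow> 'b::euclidean_space" and T :: "'b \<Rightarrow> 'c::euclidean_space"
  assumes T: "bounded_linear T" and [measurable]: "f \<in> borel_measurable M"
    and f_sq: "integrable M (\<lambda>x. (norm (f x))\<^sup>2)"
  shows "integrable M (\<lambda>x. (norm (T (f x) + c))\<^sup>2)"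
proof (rule Bochner_Integration.integrable_bound)
  show "integrable M (\<lambda>x. 2 * (onorm T)\<^sup>2 * (norm (f x))\<^sup>2 + 2 * (norm c)\<^sup>2)"
    using f_sq by simp
  have [measurable]: "T \<in> borel_measurable borel"
    using T by (rule borel_measurable_bounded_linear)
  show "(\<lambda>x. (norm (T (f x) + c))\<^sup>2) \<in> borel_measurable M"
    by measurable
  have "(norm (T v + c))\<^sup>2 \<le> 2 * (onorm T)\<^sup>2 * (norm v)\<^sup>2 + 2 * (norm c)\<^sup>2" for v
    using norm_add_sq_le[of "T v" c] power_mono[OF onorm[OF T, of v] norm_ge_zero, of 2]
    by (simp add: power_mult_distrib)
  then show "AE x in M. norm ((norm (T (f x) + c))\<^sup>2) \<le> norm (2 * (onorm T)\<^sup>2 * (norm (f x))\<^sup>2 + 2 * (norm c)\<^sup>2)"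
    by (intro AE_I2) (simp add: order_trans[OF _ abs_ge_self])
qed

lemma (in prob_space) affine_image_minus_expectation:
  fixes f :: "'a \<Rightarrow> 'b::euclidean_space" and T :: "'b \<Rightarrow> 'c::euclidean_space"
  assumes f: "integrable M f" and T: "bounded_linear T" and g: "\<And>x. g x = T (f x) + c"
  shows "integrable M g" and "g x - (\<integral>z. g z \<partial>M) = T (f x - (\<integral>z. f z \<partial>M))"
proof -
  show "integrable M g"
    unfolding g using integrable_bounded_linear[OF T f] by simp
  have "(\<integral>z. g z \<partial>M) = T (\<integral>z. f z \<partial>M) + c"
    using f T by (simp add: g integral_bounded_linear integrable_bounded_linear prob_space)
  then show "g x - (\<integral>z. g z \<partial>M) = T (f x - (\<integral>z. f z \<partial>M))"
    using T by (simp add: g linear_diff bounded_linear.linear)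
qed

lemma (in prob_space) trace_cross_cov_centered:
  fixes U V :: "'a \<Rightarrow> real^'n::finite"
  assumes [measurable]: "U \<in> borel_measurable M" "V \<in> borel_measurable M"
    and U_sq: "integrable M (\<lambda>w. (norm (U w))\<^sup>2)" and V_sq: "integrable M (\<lambda>w. (norm (V w))\<^sup>2)"
    and U_0: "(\<integral>w. U w \<partial>M) = 0" and V_0: "(\<integral>w. V w \<partial>M) = 0"
  shows "trace (cross_cov M U V) = (\<integral>w. V w \<bullet> U w \<partial>M)"
proof -
  have "(\<integral>w. U w $ i \<partial>M) = (\<integral>w. U w \<partial>M) $ i" and "(\<integral>w. V w $ i \<partial>M) = (\<integral>w. V w \<partial>M) $ i" for i
    using U_sq V_sq
    by (simp_all add: integral_bounded_linear[OF bounded_linear_vec_nth] integrable_of_integrable_norm_sq)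
  then have means: "(\<integral>w. U w $ i \<partial>M) = 0" "(\<integral>w. V w $ i \<partial>M) = 0" for i
    by (simp_all add: U_0 V_0)
  have "integrable M (\<lambda>w. U w $ i * V w $ i)" for i
  proof (rule Bochner_Integration.integrable_bound)
    show "integrable M (\<lambda>w. (norm (U w))\<^sup>2 + (norm (V w))\<^sup>2)"
      using U_sq V_sq by simp
    show "(\<lambda>w. U w $ i * V w $ i) \<in> borel_measurable M"
      by measurable
    have "\<bar>a * b\<bar> \<le> a\<^sup>2 + b\<^sup>2" for a b :: real
      using sum_squares_bound[of "\<bar>a\<bar>" "\<bar>b\<bar>"] mult_nonneg_nonneg[of "\<bar>a\<bar>" "\<bar>b\<bar>"]
      unfolding abs_mult power2_abs by linarith
    then have "\<bar>U w $ i * V w $ i\<bar> \<le> (norm (U w))\<^sup>2 + (norm (V w))\<^sup>2" for w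
      using component_sq_le_norm_sq_cart[of "U w" i] component_sq_le_norm_sq_cart[of "V w" i]
      by (meson add_mono order_trans)
    then show "AE w in M. norm (U w $ i * V w $ i) \<le> norm ((norm (U w))\<^sup>2 + (norm (V w))\<^sup>2)"
      by (intro AE_I2) simp
  qed
  then have "trace (cross_cov M U V) = (\<integral>w. (\<Sum>i\<in>UNIV. U w $ i * V w $ i) \<partial>M)"
    by (simp add: trace_def cross_cov_def means)
  then show ?thesis
    by (simp add: inner_vec_def mult.commute)
qed

lemma (in prob_space) trace_cross_cov_linear_images:
  fixes D :: "'a \<Rightarrow> real^'n::finite" and T1 T2 :: "real^'n \<Rightarrow> real^'m::finite"
  assumes [measurable]: "D \<in> borel_measurable M"
    and D_sq: "integrable M (\<lambda>w. (norm (D w))\<^sup>2)" and D_0: "(\<integral>w. D w \<partial>M) = 0"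
    and T1: "bounded_linear T1" and T2: "bounded_linear T2"
  shows "trace (cross_cov M (\<lambda>w. T1 (D w)) (\<lambda>w. T2 (D w))) = (\<integral>w. T2 (D w) \<bullet> T1 (D w) \<partial>M)"
proof -
  have [measurable]: "T1 \<in> borel_measurable borel" "T2 \<in> borel_measurable borel"
    using T1 T2 by (simp_all add: borel_measurable_bounded_linear)
  have mean: "(\<integral>w. T (D w) \<partial>M) = 0" if "bounded_linear T" for T :: "real^'n \<Rightarrow> real^'m"
    using that integrable_of_integrable_norm_sq[OF _ D_sq] D_0
    by (simp add: integral_bounded_linear linear_simps(3) bounded_linear.linear)
  have square: "integrable M (\<lambda>w. (norm (T (D w)))\<^sup>2)" if "bounded_linear T" for T :: "real^'n \<Rightarrow> real^'m"
    using integrable_norm_sq_affine[OF that _ D_sq, of 0] by simp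
  show ?thesis
    by (rule trace_cross_cov_centered) (measurable, measurable, rule square T1 T2 mean)+
qed

lemma integrable_quadratic_form:
  fixes D :: "'a \<Rightarrow> real^'n::finite"
  assumes [measurable]: "D \<in> borel_measurable M" and D_sq: "integrable M (\<lambda>w. (norm (D w))\<^sup>2)"
  shows "integrable M (\<lambda>w. D w \<bullet> (A *v D w))"
proof (rule Bochner_Integration.integrable_bound)
  show "integrable M (\<lambda>w. onorm ((*v) A) * (norm (D w))\<^sup>2)"
    using D_sq by simp
  have "\<bar>x \<bullet> (A *v x)\<bar> \<le> onorm ((*v) A) * (norm x)\<^sup>2" for x :: "real^'n"
  proof -
    have "\<bar>x \<bullet> (A *v x)\<bar> \<le> norm x * norm (A *v x)"
      by (rule Cauchy_Schwarz_ineq2)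
    also have "\<dots> \<le> norm x * (onorm ((*v) A) * norm x)"
      by (intro mult_left_mono onorm[OF matrix_vector_mul_bounded_linear]) simp
    finally show ?thesis
      by (simp add: power2_eq_square mult_ac)
  qed
  then show "AE w in M. norm (D w \<bullet> (A *v D w)) \<le> norm (onorm ((*v) A) * (norm (D w))\<^sup>2)"
    by (intro AE_I2) (simp add: order_trans[OF _ abs_ge_self])
qed measurable

lemma integral_pos_def_quadratic_form:
  fixes D :: "'a \<Rightarrow> real^'n::finite"
  assumes A: "pos_def_mat A" and [measurable]: "D \<in> borel_measurable M"
    and "integrable M (\<lambda>w. (norm (D w))\<^sup>2)"
  shows "(\<integral>w. D w \<bullet> (A *v D w) \<partial>M) \<ge> 0"
    and "(\<integral>w. D w \<bullet> (A *v D w) \<partial>M) = 0 \<longleftrightarrow> (AE w in M. D w = 0)"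
proof -
  show "(\<integral>w. D w \<bullet> (A *v D w) \<partial>M) \<ge> 0"
    using pos_def_mat_nonneg[OF A] by (simp add: Bochner_Integration.integral_nonneg)
  have "D w \<bullet> (A *v D w) = 0 \<longleftrightarrow> D w = 0" for w
    using A by (auto simp: pos_def_mat_def less_irrefl dest: spec[of _ "D w"])
  then show "(\<integral>w. D w \<bullet> (A *v D w) \<partial>M) = 0 \<longleftrightarrow> (AE w in M. D w = 0)"
    using integral_nonneg_eq_0_iff_AE[OF integrable_quadratic_form[OF assms(2,3)]]
      pos_def_mat_nonneg[OF A] by simp
qed

section \<open>Self-normalised importance sampling\<close>

lemma prob_space_ref_samples:
  assumes "pos_def_mat S"
  shows "prob_space (ref_samples N mu0 S)"
  unfolding ref_samples_def using assms by (intro prob_space_PiM prob_space_gaussian_measure)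

lemma integrable_ref_samples_component:
  fixes f :: "real^'n::finite \<Rightarrow> 'b::{banach, second_countable_topology}"
  assumes "pos_def_mat S" and "i \<in> {1..N}" and "integrable (gaussian_measure mu0 S) f"
  shows "integrable (ref_samples N mu0 S) (\<lambda>X. f (X i))"
proof -
  have "distr (ref_samples N mu0 S) (gaussian_measure mu0 S) (\<lambda>X. X i) = gaussian_measure mu0 S"
    unfolding ref_samples_def using prob_space_gaussian_measure[OF assms(1)] assms(2)
    by (intro distr_PiM_component) auto
  moreover have "(\<lambda>X. X i) \<in> measurable (ref_samples N mu0 S) (gaussian_measure mu0 S)"
    unfolding ref_samples_def using assms(2) by (rule measurable_component_singleton)
  ultimately show ?thesis
    using assms(3) by (metis integrable_distr)
qed

lemma pos_def_mat_scaleR_mat_1: "c > 0 \<Longrightarrow> pos_def_mat (c *\<^sub>R mat 1 :: real^'n::finite^'n)"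
  by (auto simp: pos_def_mat_def transpose_scalar scaleR_matrix_vector_assoc[symmetric])

lemma ou_kernel_pos: "t > 0 \<Longrightarrow> ou_kernel t y x > 0"
  unfolding ou_kernel_def by (intro gauss_density_pos pos_def_mat_scaleR_mat_1) simp

lemma borel_measurable_ou_kernel [measurable]: "ou_kernel t y \<in> borel_measurable borel"
  unfolding ou_kernel_def gauss_density_def by measurable

lemma snis_weight_nonneg: "t > 0 \<Longrightarrow> snis_weight t y N X i \<ge> 0"
  unfolding snis_weight_def by (intro divide_nonneg_nonneg sum_nonneg less_imp_le ou_kernel_pos)

lemma sum_snis_weight:
  assumes "t > 0" and "N \<ge> 1"
  shows "(\<Sum>i\<in>{1..N}. snis_weight t y N X i) = 1"
proof -
  have "(\<Sum>j\<in>{1..N}. ou_kernel t y (X j)) > 0"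
    using assms by (intro sum_pos) (auto intro: ou_kernel_pos)
  then show ?thesis
    by (simp add: snis_weight_def sum_divide_distrib[symmetric])
qed

lemma mu_SNIS_norm_sq_le:
  assumes "t > 0" and "N \<ge> 1"
  shows "(norm (mu_SNIS t y N X))\<^sup>2 \<le> (\<Sum>i\<in>{1..N}. (norm (X i))\<^sup>2)"
  unfolding mu_SNIS_def using assms
  by (intro norm_convex_combination_sq_le snis_weight_nonneg sum_snis_weight) auto

lemma borel_measurable_mu_SNIS [measurable]: "mu_SNIS t y N \<in> borel_measurable (ref_samples N mu0 S)"
  unfolding mu_SNIS_def snis_weight_def ref_samples_def by measurable

lemma integrable_mu_SNIS_norm_sq:
  assumes "pos_def_mat S" and "t > 0" and "N \<ge> 1"
  shows "integrable (ref_samples N mu0 S) (\<lambda>X. (norm (mu_SNIS t y N X))\<^sup>2)"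
proof (rule Bochner_Integration.integrable_bound)
  show "integrable (ref_samples N mu0 S) (\<lambda>X. \<Sum>i\<in>{1..N}. (norm (X i))\<^sup>2)"
    using assms(1) integrable_gaussian_measure_norm_sq[OF assms(1)]
    by (intro Bochner_Integration.integrable_sum integrable_ref_samples_component)
  show "AE X in ref_samples N mu0 S. norm ((norm (mu_SNIS t y N X))\<^sup>2) \<le> norm (\<Sum>i\<in>{1..N}. (norm (X i))\<^sup>2)"
    using mu_SNIS_norm_sq_le[OF assms(2,3)] by (intro AE_I2) (simp add: sum_nonneg)
qed measurable

lemma integrable_mu_SNIS:
  assumes "pos_def_mat S" and "t > 0" and "N \<ge> 1"
  shows "integrable (ref_samples N mu0 S) (mu_SNIS t y N)"
proof -
  interpret prob_space "ref_samples N mu0 S"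
    using assms(1) by (rule prob_space_ref_samples)
  show ?thesis
    by (rule integrable_of_integrable_norm_sq[OF borel_measurable_mu_SNIS integrable_mu_SNIS_norm_sq[OF assms]])
qed

lemma mu_SNIS_centered:
  fixes mu0 :: "real^'n::finite"
  assumes "pos_def_mat S" and "t > 0" and "N \<ge> 1"
  defines "M \<equiv> ref_samples N mu0 S"
  shows "(\<lambda>X. mu_SNIS t y N X - (\<integral>Z. mu_SNIS t y N Z \<partial>M)) \<in> borel_measurable M"
    and "integrable M (\<lambda>X. (norm (mu_SNIS t y N X - (\<integral>Z. mu_SNIS t y N Z \<partial>M)))\<^sup>2)"
    and "(\<integral>X. mu_SNIS t y N X - (\<integral>Z. mu_SNIS t y N Z \<partial>M) \<partial>M) = 0"
proof -
  interpret prob_space M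
    unfolding M_def using assms(1) by (rule prob_space_ref_samples)
  have [measurable]: "mu_SNIS t y N \<in> borel_measurable M"
    unfolding M_def by measurable
  then show "(\<lambda>X. mu_SNIS t y N X - (\<integral>Z. mu_SNIS t y N Z \<partial>M)) \<in> borel_measurable M"
    by measurable
  show "integrable M (\<lambda>X. (norm (mu_SNIS t y N X - (\<integral>Z. mu_SNIS t y N Z \<partial>M)))\<^sup>2)"
    using integrable_norm_sq_affine[OF bounded_linear_ident _
        integrable_mu_SNIS_norm_sq[OF assms(1-3), of mu0 y, folded M_def],
        of "- (\<integral>Z. mu_SNIS t y N Z \<partial>M)"]
    by simp
  show "(\<integral>X. mu_SNIS t y N X - (\<integral>Z. mu_SNIS t y N Z \<partial>M) \<partial>M) = 0"
    using integrable_mu_SNIS[OF assms(1-3), of mu0 y, folded M_def] by (simp add: prob_space)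
qed

lemma s_TSI_eq_affine:
  assumes "t > 0" and "N \<ge> 1"
  shows "s_TSI mu0 S t y N X
    = - exp t *\<^sub>R (matrix_inv S *v mu_SNIS t y N X) + exp t *\<^sub>R (matrix_inv S *v mu0)"
proof -
  have "(\<Sum>i\<in>{1..N}. snis_weight t y N X i *\<^sub>R gauss_score mu0 S (X i))
      = - (matrix_inv S *v (mu_SNIS t y N X - (\<Sum>i\<in>{1..N}. snis_weight t y N X i) *\<^sub>R mu0))"
    by (simp add: gauss_score_def mu_SNIS_def linear_sum[OF matrix_vector_mul_linear] o_def
        matrix_vector_mult_scaleR sum_negf scaleR_diff_right sum_subtractf scaleR_sum_left
        matrix_vector_mult_diff_distrib)
  then show ?thesis
    using sum_snis_weight[OF assms, of y X] by (simp add: s_TSI_def matrix_vector_mult_diff_distrib scaleR_diff_right)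
qed

lemma s_TWD_eq_affine:
  assumes "t > 0" and "N \<ge> 1"
  shows "s_TWD t y N X
    = (exp (-t) / (1 - exp (-2*t))) *\<^sub>R mu_SNIS t y N X - (1 / (1 - exp (-2*t))) *\<^sub>R y"
proof -
  have sum_eq: "(\<Sum>i\<in>{1..N}. snis_weight t y N X i *\<^sub>R (y - exp (-t) *\<^sub>R X i))
      = (\<Sum>i\<in>{1..N}. snis_weight t y N X i) *\<^sub>R y - exp (-t) *\<^sub>R mu_SNIS t y N X"
    by (simp add: mu_SNIS_def scaleR_diff_right sum_subtractf scaleR_sum_left scaleR_sum_right mult.commute)
  show ?thesis
    unfolding s_TWD_def sum_eq sum_snis_weight[OF assms] by (simp add: scaleR_diff_right)
qed

lemma s_TSI_minus_expectation:
  fixes mu0 :: "real^'n::finite"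
  assumes "pos_def_mat S" and "t > 0" and "N \<ge> 1"
  defines "M \<equiv> ref_samples N mu0 S"
  shows "integrable M (s_TSI mu0 S t y N)"
    and "s_TSI mu0 S t y N X - (\<integral>Z. s_TSI mu0 S t y N Z \<partial>M)
      = - exp t *\<^sub>R (matrix_inv S *v (mu_SNIS t y N X - (\<integral>Z. mu_SNIS t y N Z \<partial>M)))"
proof -
  interpret prob_space M
    unfolding M_def using assms(1) by (rule prob_space_ref_samples)
  have "bounded_linear (\<lambda>v. - exp t *\<^sub>R (matrix_inv S *v v))"
    by (rule bounded_linear_compose[OF bounded_linear_scaleR_right matrix_vector_mul_bounded_linear])
  from affine_image_minus_expectation[OF integrable_mu_SNIS[OF assms(1-3), of mu0 y, folded M_def]
      this s_TSI_eq_affine[OF assms(2,3)]]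
  show "integrable M (s_TSI mu0 S t y N)"
    and "s_TSI mu0 S t y N X - (\<integral>Z. s_TSI mu0 S t y N Z \<partial>M)
      = - exp t *\<^sub>R (matrix_inv S *v (mu_SNIS t y N X - (\<integral>Z. mu_SNIS t y N Z \<partial>M)))"
    by simp_all
qed

lemma s_TWD_minus_expectation:
  fixes mu0 :: "real^'n::finite"
  assumes "pos_def_mat S" and "t > 0" and "N \<ge> 1"
  defines "M \<equiv> ref_samples N mu0 S"
  shows "integrable M (s_TWD t y N)"
    and "s_TWD t y N X - (\<integral>Z. s_TWD t y N Z \<partial>M)
      = (exp (-t) / (1 - exp (-2*t))) *\<^sub>R (mu_SNIS t y N X - (\<integral>Z. mu_SNIS t y N Z \<partial>M))"
proof -
  interpret prob_space M
    unfolding M_def using assms(1) by (rule prob_space_ref_samples)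
  have "s_TWD t y N X = (exp (-t) / (1 - exp (-2*t))) *\<^sub>R mu_SNIS t y N X + - (1 / (1 - exp (-2*t))) *\<^sub>R y"
    for X
    using s_TWD_eq_affine[OF assms(2,3)] by simp
  from affine_image_minus_expectation[OF integrable_mu_SNIS[OF assms(1-3), of mu0 y, folded M_def]
      bounded_linear_scaleR_right this]
  show "integrable M (s_TWD t y N)"
    and "s_TWD t y N X - (\<integral>Z. s_TWD t y N Z \<partial>M)
      = (exp (-t) / (1 - exp (-2*t))) *\<^sub>R (mu_SNIS t y N X - (\<integral>Z. mu_SNIS t y N Z \<partial>M))"
    by simp_all
qed

theorem proposition3p2:
  fixes S :: "real^'d^'d" and mu0 y :: "real^'d" and t :: real and N :: nat
  assumes "pos_def_mat S" and "t > 0" and "N \<ge> 1"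
  defines "M \<equiv> ref_samples N mu0 S"
  defines "Delta \<equiv> (\<lambda>X. mu_SNIS t y N X - (\<integral>Z. mu_SNIS t y N Z \<partial>M))"
  defines "epsC \<equiv> (\<lambda>X. s_TSI mu0 S t y N X - (\<integral>Z. s_TSI mu0 S t y N Z \<partial>M))"
  defines "epsT \<equiv> (\<lambda>X. s_TWD t y N X - (\<integral>Z. s_TWD t y N Z \<partial>M))"
  shows "integrable M (mu_SNIS t y N) \<and> integrable M (s_TSI mu0 S t y N)
           \<and> integrable M (s_TWD t y N)
         \<and> (\<forall>X\<in>space M. epsC X = - exp t *\<^sub>R (matrix_inv S *v Delta X))
         \<and> (\<forall>X\<in>space M. epsT X = (exp (-t) / (1 - exp (-2*t))) *\<^sub>R Delta X)
         \<and> trace (cross_cov M epsC epsT) = (\<integral>X. epsT X \<bullet> epsC X \<partial>M)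
         \<and> (\<integral>X. epsT X \<bullet> epsC X \<partial>M)
               = - (1 / (1 - exp (-2*t))) * (\<integral>X. Delta X \<bullet> (matrix_inv S *v Delta X) \<partial>M)
         \<and> - (1 / (1 - exp (-2*t))) * (\<integral>X. Delta X \<bullet> (matrix_inv S *v Delta X) \<partial>M) \<le> 0
         \<and> ((- (1 / (1 - exp (-2*t))) * (\<integral>X. Delta X \<bullet> (matrix_inv S *v Delta X) \<partial>M) = 0)
               \<longleftrightarrow> (AE X in M. Delta X = 0))"
proof -
  interpret prob_space M
    unfolding M_def using assms(1) by (rule prob_space_ref_samples)
  let ?A = "matrix_inv S" and ?c = "1 - exp (-2*t)"
  have integrable: "integrable M (mu_SNIS t y N)" "integrable M (s_TSI mu0 S t y N)" "integrable M (s_TWD t y N)"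
    unfolding M_def using assms(1-3)
    by (rule integrable_mu_SNIS s_TSI_minus_expectation(1) s_TWD_minus_expectation(1))+
  have Delta: "Delta \<in> borel_measurable M" "integrable M (\<lambda>X. (norm (Delta X))\<^sup>2)" "(\<integral>X. Delta X \<partial>M) = 0"
    unfolding Delta_def M_def using mu_SNIS_centered[OF assms(1-3)] by simp_all
  have epsC: "epsC = (\<lambda>X. - exp t *\<^sub>R (?A *v Delta X))"
    and epsT: "epsT = (\<lambda>X. (exp (-t) / ?c) *\<^sub>R Delta X)"
    unfolding epsC_def epsT_def Delta_def M_def
    by (simp_all add: s_TSI_minus_expectation(2)[OF assms(1-3)] s_TWD_minus_expectation(2)[OF assms(1-3)])
  have trace: "trace (cross_cov M epsC epsT) = (\<integral>X. epsT X \<bullet> epsC X \<partial>M)"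
    unfolding epsC epsT using Delta
    by (intro trace_cross_cov_linear_images bounded_linear_scaleR_right
        bounded_linear_compose[OF bounded_linear_scaleR_right matrix_vector_mul_bounded_linear])
  have "exp (-t) / ?c * - exp t = - (1 / ?c)"
    using exp_minus_inverse[of t] by (simp add: mult.commute)
  then have "epsT X \<bullet> epsC X = - (1 / ?c) * (Delta X \<bullet> (?A *v Delta X))" for X
    unfolding epsC epsT by (metis inner_scaleR_left inner_scaleR_right mult.assoc)
  then have "(\<integral>X. epsT X \<bullet> epsC X \<partial>M) = - (1 / ?c) * (\<integral>X. Delta X \<bullet> (?A *v Delta X) \<partial>M)"
    by simp
  moreover note integral_pos_def_quadratic_form[OF pos_def_mat_matrix_inv[OF assms(1)] Delta(1,2)]
  moreover have "?c > 0"
    using assms(2) by simp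
  ultimately show ?thesis
    using integrable trace by (simp add: epsC epsT mult_le_0_iff)
qed

end
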